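(* Let $A,B,H,K$ be any logically independent events. Given a coherent assessment $(x,y)$ on $\{A|H,B|K\}$, for the iterated conditional $(B|K)|_{B}(A|H)$ the extension $\mu_B=\mathbb{P}((B|K)|_{B}(A|H))$ is coherent if and only if $\mu_B\in[\mu_B',\mu_B'']$, where $$\mu_B'=0,\qquad \mu_B''=\begin{cases}\frac{1}{x}, & \text{if } 0<x<1,\\ 1, & \text{if } x=0 \text{ or } x=1.\end{cases}$$
   Context: Events are two-valued entities identified with their indicators (values $1/0$); $\emptyset$ is the impossible event, $AB=A\wedge B$, $\overline{A}$ is the negation. Four events are logically independent if all $16$ conjunctions obtained by taking each event or its negation are different from $\emptyset$. For $H\neq\emptyset$ the conditional event $E|H$ is true if $EH$ is true, false if $\overline{E}H$ is true, void if $\overline{H}$ is true. Once $P(E|H)=p$ is assessed, $E|H$ is also the random quantity $EH+p\overline{H}$; numerically $\overline{A}|H=1-A|H$. Bochvar–Kleene conjunction (a conditional event; the subscript $B$ is only a name, unrelated to the event $B$): $(A|H)\wedge_B(B|K)=AHBK|HK$. Iterated conditional: $(B|K)|_B(A|H)$ is the random quantity $(A|H)\wedge_B(B|K)+\mu_B\,(\overline{A}|H)$, where $\mu_B$ is its assessed prevision (the amount paid to receive it), the right-hand side being computed numerically from $x=P(A|H)$, $z=P[(A|H)\wedge_B(B|K)]$ and $\mu_B$. Also $y=P(B|K)$. Coherence: an assessment of real values $m_j$ on a finite family of such objects $X_j$ (conditional events, as random quantities, and iterated conditionals) is coherent iff for every nonempty subfamily $J$ and all reals $s_j$, the random gain $\sum_{j\in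 J}s_j(X_j-m_j)$, restricted to the cases where at least one of the bets in $J$ is not called off, has minimum $\le 0$ and maximum $\ge 0$. A bet on a conditional event is called off when it is void; a bet on the iterated conditional is called off in the cases where one receives back the paid amount $\mu_B$ whatever it is (taking into account the relation $z=x\mu_B$ required by linearity of coherent previsions). The value $\mu_B$ is a coherent extension of $(x,y)$ iff there is $z$ such that $(x,y,z,\mu_B)$ is coherent on $\{A|H,B|K,(A|H)\wedge_B(B|K),(B|K)|_B(A|H)\}$. *)

theory Defs
  imports Complex_Main "HOL-Library.Indicator_Function"
begin

text \<open>Events are sets of elementary cases \<open>\<omega> :: 'w\<close>; the impossible event is the empty set.\<close>

definition logically_independent :: "'w set \<Rightarrow> 'w set \<Rightarrow> 'w set \<Rightarrow> 'w set \<Rightarrow> bool" where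
  "logically_independent A B H K \<longleftrightarrow>
     (\<forall>A' \<in> {A, -A}. \<forall>B' \<in> {B, -B}. \<forall>H' \<in> {H, -H}. \<forall>K' \<in> {K, -K}.
        A' \<inter> B' \<inter> H' \<inter> K' \<noteq> {})"

text \<open>\<open>Cond E H\<close> is the conditional event \<open>E|H\<close>; it is meant for \<open>H \<noteq> {}\<close>.\<close>

datatype 'w cond_event = Cond "'w set" "'w set"

fun void :: "'w cond_event \<Rightarrow> 'w set" where
  "void (Cond E H) = -H"

text \<open>The random quantity \<open>E H + p (not H)\<close> associated with \<open>E|H\<close> once \<open>P(E|H) = p\<close> is assessed.\<close>

fun ce_val :: "'w cond_event \<Rightarrow> real \<Rightarrow> 'w \<Rightarrow> real" where
  "ce_val (Cond E H) p \<omega> = indicator (E \<inter> H) \<omega> + p * indicator (-H) \<omega>"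

fun ce_neg :: "'w cond_event \<Rightarrow> 'w cond_event" where
  "ce_neg (Cond E H) = Cond (-E) H"

lemma ce_val_neg: "ce_val (ce_neg c) (1 - p) \<omega> = 1 - ce_val c p \<omega>"
  by (cases c) (auto simp: indicator_def)

text \<open>Bochvar--Kleene conjunction.\<close>

fun conj_B :: "'w cond_event \<Rightarrow> 'w cond_event \<Rightarrow> 'w cond_event" where
  "conj_B (Cond A H) (Cond B K) = Cond (A \<inter> H \<inter> B \<inter> K) (H \<inter> K)"

text \<open>\<open>iter_val c d x z \<mu>\<close> is the iterated conditional \<open>d |\<^sub>B c\<close> (the conditioning object \<open>c\<close>
  comes first), where \<open>x\<close>, \<open>z\<close> and \<open>\<mu>\<close> are the assessments of \<open>c\<close>, of \<open>conj_B c d\<close> and of the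
  iterated conditional itself.\<close>

definition iter_val ::
  "'w cond_event \<Rightarrow> 'w cond_event \<Rightarrow> real \<Rightarrow> real \<Rightarrow> real \<Rightarrow> 'w \<Rightarrow> real" where
  "iter_val c d x z \<mu> \<omega> = ce_val (conj_B c d) z \<omega> + \<mu> * ce_val (ce_neg c) (1 - x) \<omega>"

text \<open>The cases where the paid amount \<open>m\<close> is received back whatever it is, under the relation
  \<open>z = x * m\<close> imposed by linearity. This set depends on \<open>x\<close>: for \<open>x = 1\<close> it also contains the
  cases \<open>A H (not K)\<close>, and for \<open>x = 0\<close> the cases \<open>(not A) H (not K)\<close>.\<close>

definition iter_off :: "'w cond_event \<Rightarrow> 'w cond_event \<Rightarrow> real \<Rightarrow> 'w set" where
  "iter_off c d x = {\<omega>. \<forall>m. iter_val c d x (x * m) m \<omega> = m}"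

text \<open>A bet: a random quantity, its assessed value, and the cases where the bet is called off.\<close>

datatype 'w bet = Bet (quantity: "'w \<Rightarrow> real") (price: real) (called_off: "'w set")

definition ce_bet :: "'w cond_event \<Rightarrow> real \<Rightarrow> 'w bet" where
  "ce_bet c p = Bet (ce_val c p) p (void c)"

definition iter_bet ::
  "'w cond_event \<Rightarrow> 'w cond_event \<Rightarrow> real \<Rightarrow> real \<Rightarrow> real \<Rightarrow> 'w bet" where
  "iter_bet c d x z \<mu> = Bet (iter_val c d x z \<mu>) \<mu> (iter_off c d x)"

definition gain :: "'w bet list \<Rightarrow> nat set \<Rightarrow> (nat \<Rightarrow> real) \<Rightarrow> 'w \<Rightarrow> real" where
  "gain bs J s \<omega> = (\<Sum>j\<in>J. s j * (quantity (bs ! j) \<omega> - price (bs ! j)))"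

definition active :: "'w bet list \<Rightarrow> nat set \<Rightarrow> 'w set" where
  "active bs J = {\<omega>. \<exists>j\<in>J. \<omega> \<notin> called_off (bs ! j)}"

text \<open>The quantities considered here take finitely many values and no bet is called off in every
  case, so \<open>Min\<close> and \<open>Max\<close> are taken over finite nonempty sets, even if \<open>'w\<close> is infinite.\<close>

definition coherent :: "'w bet list \<Rightarrow> bool" where
  "coherent bs \<longleftrightarrow>
     (\<forall>J s. J \<subseteq> {..<length bs} \<and> J \<noteq> {} \<longrightarrow>
        Min (gain bs J s ` active bs J) \<le> 0 \<and> Max (gain bs J s ` active bs J) \<ge> 0)"

definition coherent_extension ::
  "'w cond_event \<Rightarrow> 'w cond_event \<Rightarrow> real \<Rightarrow> real \<Rightarrow> real \<Rightarrow> bool" where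
  "coherent_extension c d x y \<mu> \<longleftrightarrow>
     (\<exists>z. coherent [ce_bet c x, ce_bet d y, ce_bet (conj_B c d) z, iter_bet c d x z \<mu>])"

end

theory Submission imports Defs begin

text \<open>
  Write \<open>q - m\<close> for the unit gain of a bet with quantity \<open>q\<close> and price \<open>m\<close>. By construction of the
  iterated conditional its unit gain equals, case by case, the unit gain on the conjunction, minus
  \<open>\<mu>\<close> times the unit gain on \<open>A|H\<close>, plus the constant \<open>z - x * \<mu>\<close>. Buying and selling accordingly
  leaves this constant as the gain in every case, so coherence forces \<open>z = x * \<mu>\<close>
  (\<open>compound_prevision\<close>).

  Necessity is then a matter of single bets: a coherent price lies between the values that the
  quantity takes when the bet is not called off (\<open>price_within_active_values\<close>). For the conjunction
  this says \<open>0 \<le> x * \<mu> \<le> 1\<close>, which is the claimed bound when \<open>x > 0\<close>. When \<open>x = 0\<close> it says nothing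
  about \<open>\<mu>\<close>; but then \<open>z = 0\<close>, so the iterated conditional returns \<open>\<mu>\<close> unless \<open>A H\<close> is true. In all those
  cases the bet is called off, and in the remaining ones it is worth 0 or 1, whence \<open>0 \<le> \<mu> \<le> 1\<close>.

  For sufficiency, take \<open>z = x * \<mu>\<close>. A family of bets cannot produce a sure gain or a sure loss if
  some probability on its active cases makes each of its bets fair (\<open>coherent_if_fair_lotteries\<close>),
  and probabilities on two cases are enough here. A conjunction is void as soon as one of its
  members is, so by logical independence each of \<open>A|H\<close> and \<open>B|K\<close> can be settled while the
  conjunction is void. This is why the price \<open>z\<close> is subject to no constraint from \<open>x\<close> and \<open>y\<close>
  beyond \<open>0 \<le> z \<le> 1\<close>. A family containing \<open>B|K\<close> is fair under a lottery between \<open>B K\<close> and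
  \<open>(not B) K\<close> that never meets \<open>H\<close>, and one containing \<open>A|H\<close> under a lottery between \<open>A H\<close> and
  \<open>(not A) H\<close> that never meets \<open>K\<close>. What is left are families made of the conjunction and the
  iterated conditional, and only there do the values \<open>x = 0\<close> and \<open>x = 1\<close> play a special part.
\<close>

section \<open>Coherence through gains in single cases\<close>

lemma finite_range_gain:
  assumes "\<forall>b \<in> set bs. finite (range (quantity b))" "J \<subseteq> {..<length bs}"
  shows "finite (range (gain bs J s))"
proof -
  have "finite J"
    using assms(2) finite_subset by blast
  then show ?thesis
    using assms(2)
  proof (induction J)
    case empty
    show ?case
      by (auto simp: gain_def)
  next
    case (insert i J)
    have "finite (range (quantity (bs ! i)))"
      using insert.prems assms(1) by auto
    moreover have "finite (range (gain bs J s))"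
      using insert by auto
    ultimately have "finite ((\<lambda>(q, g). s i * (q - price (bs ! i)) + g) `
        (range (quantity (bs ! i)) \<times> range (gain bs J s)))"
      by blast
    moreover have "range (gain bs (insert i J) s) \<subseteq> (\<lambda>(q, g). s i * (q - price (bs ! i)) + g) `
        (range (quantity (bs ! i)) \<times> range (gain bs J s))"
      using insert.hyps by (force simp: gain_def)
    ultimately show ?case
      by (rule finite_subset[rotated])
  qed
qed

lemma coherentE:
  assumes "coherent bs" "\<forall>b \<in> set bs. finite (range (quantity b))"
    and "J \<subseteq> {..<length bs}" "active bs J \<noteq> {}"
  obtains \<omega> \<omega>' where "\<omega> \<in> active bs J" "gain bs J s \<omega> \<le> 0"
    "\<omega>' \<in> active bs J" "gain bs J s \<omega>' \<ge> 0"
proof -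
  have "finite (gain bs J s ` active bs J)"
    using finite_range_gain[OF assms(2,3)] by (meson finite_subset image_mono subset_UNIV)
  moreover have "J \<noteq> {}"
    using assms(4) by (auto simp: active_def)
  ultimately have "Min (gain bs J s ` active bs J) \<in> gain bs J s ` active bs J"
    "Max (gain bs J s ` active bs J) \<in> gain bs J s ` active bs J"
    "Min (gain bs J s ` active bs J) \<le> 0" "Max (gain bs J s ` active bs J) \<ge> 0"
    using assms(1,3,4) by (auto simp: coherent_def)
  then show thesis
    using that by auto
qed

lemma price_within_active_values:
  assumes "coherent bs" "\<forall>b \<in> set bs. finite (range (quantity b))"
    and "i < length bs" "called_off (bs ! i) \<noteq> UNIV"
    and "\<And>\<omega>. \<omega> \<notin> called_off (bs ! i) \<Longrightarrow> l \<le> quantity (bs ! i) \<omega> \<and> quantity (bs ! i) \<omega> \<le> u"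
  shows "l \<le> price (bs ! i)" "price (bs ! i) \<le> u"
proof -
  have act: "active bs {i} = - called_off (bs ! i)"
    by (auto simp: active_def)
  obtain \<omega> \<omega>' where "\<omega> \<in> active bs {i}" "gain bs {i} (\<lambda>_. 1) \<omega> \<le> 0"
    and "\<omega>' \<in> active bs {i}" "gain bs {i} (\<lambda>_. 1) \<omega>' \<ge> 0"
    using coherentE[OF assms(1,2), of "{i}" "\<lambda>_. 1"] assms(3,4) act by auto
  then show "l \<le> price (bs ! i)" "price (bs ! i) \<le> u"
    using assms(5)[of \<omega>] assms(5)[of \<omega>'] by (auto simp: act gain_def)
qed

text \<open>If each bet of the family is fair under a lottery with active outcomes \<open>a\<close> and \<open>b\<close>, then so is
  every combination of them: the gains in \<open>a\<close> and \<open>b\<close> average to 0 and cannot have the same strict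
  sign.\<close>

lemma coherent_if_fair_lotteries:
  assumes fin: "\<forall>b \<in> set bs. finite (range (quantity b))"
    and fair: "\<And>J. J \<subseteq> {..<length bs} \<Longrightarrow> J \<noteq> {} \<Longrightarrow>
      \<exists>a \<in> active bs J. \<exists>b \<in> active bs J. \<exists>t. 0 \<le> t \<and> t \<le> 1 \<and>
        (\<forall>j\<in>J. t * quantity (bs ! j) a + (1 - t) * quantity (bs ! j) b = price (bs ! j))"
  shows "coherent bs"
  unfolding coherent_def
proof (intro allI impI)
  fix J and s :: "nat \<Rightarrow> real"
  assume J: "J \<subseteq> {..<length bs} \<and> J \<noteq> {}"
  then obtain a b t where ab: "a \<in> active bs J" "b \<in> active bs J" and t: "0 \<le> t" "t \<le> 1"
    and eq: "\<And>j. j \<in> J \<Longrightarrow>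
      t * quantity (bs ! j) a + (1 - t) * quantity (bs ! j) b = price (bs ! j)"
    using fair by meson
  let ?g = "gain bs J s"
  have "t * ?g a + (1 - t) * ?g b
      = (\<Sum>j\<in>J. s j * (t * quantity (bs ! j) a + (1 - t) * quantity (bs ! j) b - price (bs ! j)))"
    unfolding gain_def sum_distrib_left sum.distrib[symmetric]
    by (rule sum.cong) (auto simp: algebra_simps)
  also have "\<dots> = 0"
    using eq by simp
  finally have zero: "t * ?g a + (1 - t) * ?g b = 0" .
  have nonpos: "?g a \<le> 0 \<or> ?g b \<le> 0"
  proof (rule ccontr)
    assume "\<not> ?thesis"
    then have "0 < t * ?g a + (1 - t) * ?g b"
      using t convex_bound_lt[of "- ?g a" 0 "- ?g b" t "1 - t"] by auto
    with zero show False
      by simp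
  qed
  have nonneg: "0 \<le> ?g a \<or> 0 \<le> ?g b"
  proof (rule ccontr)
    assume "\<not> ?thesis"
    then have "t * ?g a + (1 - t) * ?g b < 0"
      using t convex_bound_lt[of "?g a" 0 "?g b" t "1 - t"] by auto
    with zero show False
      by simp
  qed
  have "finite (?g ` active bs J)"
    using finite_range_gain[OF fin] J by (meson finite_subset image_mono subset_UNIV)
  moreover have "?g a \<in> ?g ` active bs J" "?g b \<in> ?g ` active bs J"
    using ab by auto
  ultimately have "Min (?g ` active bs J) \<le> ?g a" "Min (?g ` active bs J) \<le> ?g b"
    "?g a \<le> Max (?g ` active bs J)" "?g b \<le> Max (?g ` active bs J)"
    by auto
  then show "Min (?g ` active bs J) \<le> 0 \<and> Max (?g ` active bs J) \<ge> 0"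
    using nonpos nonneg by linarith
qed

section \<open>Conditional events and iterated conditionals as bets\<close>

lemma bet_simps [simp]:
  "quantity (ce_bet c p) = ce_val c p"
  "price (ce_bet c p) = p"
  "called_off (ce_bet c p) = void c"
  "quantity (iter_bet c d x z \<mu>) = iter_val c d x z \<mu>"
  "price (iter_bet c d x z \<mu>) = \<mu>"
  "called_off (iter_bet c d x z \<mu>) = iter_off c d x"
  by (auto simp: ce_bet_def iter_bet_def)

lemma iter_val_eq: "iter_val c d x z \<mu> \<omega> = ce_val (conj_B c d) z \<omega> + \<mu> * (1 - ce_val c x \<omega>)"
  by (simp add: iter_val_def ce_val_neg)

lemma finite_range_ce_val: "finite (range (ce_val c p))"
proof (rule finite_subset)
  show "range (ce_val c p) \<subseteq> {0, 1, p}"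
    by (cases c) (auto simp: indicator_def)
qed auto

lemma finite_range_iter_val: "finite (range (iter_val c d x z \<mu>))"
proof (rule finite_subset)
  show "range (iter_val c d x z \<mu>) \<subseteq> (\<lambda>(v, w). v + \<mu> * (1 - w)) `
      (range (ce_val (conj_B c d) z) \<times> range (ce_val c x))"
    by (auto simp: iter_val_eq)
qed (simp add: finite_range_ce_val)

lemma iter_off_iff:
  "\<omega> \<in> iter_off (Cond A H) (Cond B K) x \<longleftrightarrow>
    \<omega> \<notin> H \<or> (\<omega> \<notin> A \<and> \<omega> \<in> K) \<or> (\<omega> \<notin> A \<and> \<omega> \<notin> K \<and> x = 0) \<or> (\<omega> \<in> A \<and> \<omega> \<notin> K \<and> x = 1)"
proof -
  \<comment> \<open>on \<open>A H K\<close> the value 0 or 1 does not depend on the paid amount\<close>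
  have "\<exists>m::real. m \<noteq> 1"
    by (rule exI[of _ 0]) simp
  moreover have nonzero: "\<not> (\<forall>m::real. m = 0)"
    by (metis one_neq_zero)
  moreover have "(\<forall>m::real. x * m = m) \<longleftrightarrow> x = 1"
    by (metis mult.right_neutral mult_1)
  ultimately show ?thesis
    by (cases "\<omega> \<in> H"; cases "\<omega> \<in> K"; cases "\<omega> \<in> A"; cases "\<omega> \<in> B")
      (simp_all add: iter_off_def iter_val_eq nonzero algebra_simps)
qed

lemma ce_price_bounds:
  assumes "coherent bs" "\<forall>b \<in> set bs. finite (range (quantity b))"
    and "i < length bs" "bs ! i = ce_bet (Cond E H) p" "H \<noteq> {}"
  shows "0 \<le> p" "p \<le> 1"
  using price_within_active_values[OF assms(1-3), of 0 1] assms(4,5)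
  by (auto simp: indicator_def)

lemma logically_independentE:
  assumes "logically_independent A B H K"
  obtains \<omega> where "\<omega> \<in> A \<longleftrightarrow> a" "\<omega> \<in> B \<longleftrightarrow> b" "\<omega> \<in> H \<longleftrightarrow> h" "\<omega> \<in> K \<longleftrightarrow> k"
proof -
  let ?S = "\<lambda>E e. if e then E else - E"
  have "?S A a \<inter> ?S B b \<inter> ?S H h \<inter> ?S K k \<noteq> {}"
    using assms unfolding logically_independent_def by simp
  then show thesis
    using that by (auto split: if_splits)
qed

section \<open>Coherent prices of the iterated conditional\<close>

abbreviation family ::
  "'w cond_event \<Rightarrow> 'w cond_event \<Rightarrow> real \<Rightarrow> real \<Rightarrow> real \<Rightarrow> real \<Rightarrow> 'w bet list" where
  "family c d x y z \<mu> \<equiv> [ce_bet c x, ce_bet d y, ce_bet (conj_B c d) z, iter_bet c d x z \<mu>]"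

lemma finite_range_family: "\<forall>b \<in> set (family c d x y z \<mu>). finite (range (quantity b))"
  by (auto simp: finite_range_ce_val finite_range_iter_val)

lemma compound_prevision:
  assumes coh: "coherent (family c d x y z \<mu>)" and "void c \<noteq> UNIV"
  shows "z = x * \<mu>"
proof -
  let ?bs = "family c d x y z \<mu>" and ?J = "{0, 2, 3::nat}"
  \<comment> \<open>buy the iterated conditional, sell the conjunction, buy \<open>\<mu>\<close> units of \<open>c\<close>\<close>
  define s where "s = (\<lambda>j::nat. if j = 0 then \<mu> else if j = 2 then - 1 else 1)"
  have "gain ?bs ?J s \<omega> = z - x * \<mu>" for \<omega>
    by (simp add: gain_def s_def iter_val_eq algebra_simps)
  moreover obtain \<omega> \<omega>' where "gain ?bs ?J s \<omega> \<le> 0" "gain ?bs ?J s \<omega>' \<ge> 0"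
  proof (rule coherentE[OF coh finite_range_family])
    show "active ?bs ?J \<noteq> {}"
      using assms(2) by (auto simp: active_def)
  qed auto
  ultimately show ?thesis
    by simp
qed

lemma iter_price_bounds:
  assumes coh: "coherent (family (Cond A H) (Cond B K) x y z \<mu>)"
    and "A \<inter> H \<inter> K \<noteq> {}" and x: "0 \<le> x" "x \<le> 1"
  shows "0 \<le> \<mu> \<and> \<mu> \<le> (if 0 < x \<and> x < 1 then 1 / x else 1)"
proof -
  let ?bs = "family (Cond A H) (Cond B K) x y z \<mu>"
  have z: "z = x * \<mu>"
    using compound_prevision[OF coh] assms(2) by auto
  show ?thesis
  proof (cases "x = 0")
    case True
    obtain \<omega> where "\<omega> \<in> A" "\<omega> \<in> H" "\<omega> \<in> K"
      using assms(2) by auto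
    then have "iter_off (Cond A H) (Cond B K) x \<noteq> UNIV"
      by (auto simp: set_eq_iff iter_off_iff)
    moreover have "0 \<le> iter_val (Cond A H) (Cond B K) x z \<mu> \<omega> \<and>
        iter_val (Cond A H) (Cond B K) x z \<mu> \<omega> \<le> 1"
      if "\<omega> \<notin> iter_off (Cond A H) (Cond B K) x" for \<omega>
      using that True z by (auto simp: iter_off_iff iter_val_eq indicator_def)
    ultimately show ?thesis
      using price_within_active_values[OF coh finite_range_family, where i = 3 and l = 0 and u = 1] True by simp
  next
    case False
    have "H \<inter> K \<noteq> {}"
      using assms(2) by auto
    then have "0 \<le> z" "z \<le> 1"
      using ce_price_bounds[OF coh finite_range_family, where i = 2] by auto
    then show ?thesis
      using False x z by (auto simp: zero_le_mult_iff field_simps)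
  qed
qed

lemma coherent_family:
  assumes indep: "logically_independent A B H K"
    and x: "0 \<le> x" "x \<le> 1" and y: "0 \<le> y" "y \<le> 1"
    and \<mu>: "0 \<le> \<mu>" "\<mu> \<le> (if 0 < x \<and> x < 1 then 1 / x else 1)"
  shows "coherent (family (Cond A H) (Cond B K) x y (x * \<mu>) \<mu>)" (is "coherent ?bs")
proof (rule coherent_if_fair_lotteries)
  let ?fair = "\<lambda>a b t j. t * quantity (?bs ! j) a + (1 - t) * quantity (?bs ! j) b = price (?bs ! j)"
  fix J :: "nat set"
  assume "J \<subseteq> {..<length ?bs}" and "J \<noteq> {}"
  then have J: "\<And>j. j \<in> J \<Longrightarrow> j \<in> {0, 1, 2, 3}"
    by force
  \<comment> \<open>The cases \<open>\<alpha>\<close> settle \<open>A|H\<close> and the cases \<open>\<beta>\<close> settle \<open>B|K\<close>, all with a void conjunction;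
    \<open>\<gamma>\<^sub>1\<close>, \<open>\<gamma>\<^sub>0\<close> and \<open>\<delta>\<close> settle the conjunction.\<close>
  obtain \<alpha>\<^sub>1 where \<alpha>\<^sub>1: "\<alpha>\<^sub>1 \<in> A" "\<alpha>\<^sub>1 \<in> H" "\<alpha>\<^sub>1 \<notin> K"
    using logically_independentE[OF indep, of True True True False] by auto
  obtain \<alpha>\<^sub>0 where \<alpha>\<^sub>0: "\<alpha>\<^sub>0 \<notin> A" "\<alpha>\<^sub>0 \<in> H" "\<alpha>\<^sub>0 \<notin> K"
    using logically_independentE[OF indep, of False True True False] by auto
  obtain \<beta>\<^sub>1 where \<beta>\<^sub>1: "\<beta>\<^sub>1 \<in> B" "\<beta>\<^sub>1 \<notin> H" "\<beta>\<^sub>1 \<in> K"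
    using logically_independentE[OF indep, of True True False True] by auto
  obtain \<beta>\<^sub>0 where \<beta>\<^sub>0: "\<beta>\<^sub>0 \<notin> B" "\<beta>\<^sub>0 \<notin> H" "\<beta>\<^sub>0 \<in> K"
    using logically_independentE[OF indep, of True False False True] by auto
  obtain \<gamma>\<^sub>1 where \<gamma>\<^sub>1: "\<gamma>\<^sub>1 \<in> A" "\<gamma>\<^sub>1 \<in> B" "\<gamma>\<^sub>1 \<in> H" "\<gamma>\<^sub>1 \<in> K"
    using logically_independentE[OF indep, of True True True True] by auto
  obtain \<gamma>\<^sub>0 where \<gamma>\<^sub>0: "\<gamma>\<^sub>0 \<in> A" "\<gamma>\<^sub>0 \<notin> B" "\<gamma>\<^sub>0 \<in> H" "\<gamma>\<^sub>0 \<in> K"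
    using logically_independentE[OF indep, of True False True True] by auto
  obtain \<delta> where \<delta>: "\<delta> \<notin> A" "\<delta> \<in> H" "\<delta> \<in> K"
    using logically_independentE[OF indep, of False True True True] by auto
  note cases = \<alpha>\<^sub>1 \<alpha>\<^sub>0 \<beta>\<^sub>1 \<beta>\<^sub>0 \<gamma>\<^sub>1 \<gamma>\<^sub>0 \<delta>
  \<comment> \<open>On the iterated conditional the lottery \<open>\<alpha>\<close> yields on average
    \<open>x * z + (1 - x) * (z + \<mu>)\<close>, which is \<open>\<mu>\<close> because \<open>z = x * \<mu>\<close>.\<close>
  have fair_\<alpha>: "?fair \<alpha>\<^sub>1 \<alpha>\<^sub>0 x j" and fair_\<beta>: "?fair \<beta>\<^sub>1 \<beta>\<^sub>0 y j" if "j \<in> J" for j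
    using J[OF that] cases by (auto simp: iter_val_eq algebra_simps)
  have z: "0 \<le> x * \<mu>" "x * \<mu> \<le> 1"
    using x \<mu> by (auto simp: field_simps split: if_splits)
  have "J = {2}" if "0 \<notin> J" "1 \<notin> J" "3 \<notin> J"
    using J that \<open>J \<noteq> {}\<close> by blast
  moreover have "0 < x \<and> x < 1 \<or> x = 0 \<or> x = 1"
    using x by linarith
  ultimately consider "1 \<in> J" | "0 \<in> J" | "3 \<in> J" "0 < x" "x < 1"
    | "3 \<in> J" "2 \<in> J" "0 \<notin> J" "1 \<notin> J" "x = 0"
    | "3 \<in> J" "2 \<notin> J" "0 \<notin> J" "1 \<notin> J" "x = 0"
    | "3 \<in> J" "0 \<notin> J" "1 \<notin> J" "x = 1" | "J = {2}"
    by argo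
  then show "\<exists>a \<in> active ?bs J. \<exists>b \<in> active ?bs J. \<exists>t. 0 \<le> t \<and> t \<le> 1 \<and> (\<forall>j\<in>J. ?fair a b t j)"
  proof cases
    case 1
    then have "\<beta>\<^sub>1 \<in> active ?bs J" "\<beta>\<^sub>0 \<in> active ?bs J"
      using \<beta>\<^sub>1 \<beta>\<^sub>0 by (auto simp: active_def intro!: bexI[of _ 1])
    then show ?thesis
      using fair_\<beta> y by blast
  next
    case 2
    then have "\<alpha>\<^sub>1 \<in> active ?bs J" "\<alpha>\<^sub>0 \<in> active ?bs J"
      using \<alpha>\<^sub>1 \<alpha>\<^sub>0 by (auto simp: active_def intro!: bexI[of _ 0])
    then show ?thesis
      using fair_\<alpha> x by blast
  next
    case 3
    then have "\<alpha>\<^sub>1 \<in> active ?bs J" "\<alpha>\<^sub>0 \<in> active ?bs J"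
      using \<alpha>\<^sub>1 \<alpha>\<^sub>0 by (auto simp: active_def iter_off_iff intro!: bexI[of _ 3])
    then show ?thesis
      using fair_\<alpha> x by blast
  next
    case 4
    \<comment> \<open>\<open>z = 0\<close>: once \<open>A|H\<close> turns out false with \<open>K\<close> true, both bets return their price\<close>
    then have "\<delta> \<in> active ?bs J"
      using \<delta> by (auto simp: active_def intro!: bexI[of _ 2])
    moreover have "?fair \<delta> \<delta> 1 j" if "j \<in> J" for j
      using J[OF that] that 4 \<delta> by (auto simp: iter_val_eq)
    ultimately show ?thesis
      by (intro bexI[of _ \<delta>] exI[of _ 1]) auto
  next
    case 5
    \<comment> \<open>given \<open>A H K\<close>, the iterated conditional is worth 1 or 0 according to \<open>B\<close>\<close>
    then have "\<gamma>\<^sub>1 \<in> active ?bs J" "\<gamma>\<^sub>0 \<in> active ?bs J"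
      using \<gamma>\<^sub>1 \<gamma>\<^sub>0 by (auto simp: active_def iter_off_iff intro!: bexI[of _ 3])
    moreover have "?fair \<gamma>\<^sub>1 \<gamma>\<^sub>0 \<mu> j" if "j \<in> J" for j
      using J[OF that] that 5 \<gamma>\<^sub>1 \<gamma>\<^sub>0 by (auto simp: iter_val_eq)
    moreover have "\<mu> \<le> 1"
      using \<mu> 5 by simp
    ultimately show ?thesis
      using \<mu>(1) by blast
  next
    case 6
    then have "\<gamma>\<^sub>1 \<in> active ?bs J" "\<gamma>\<^sub>0 \<in> active ?bs J"
      using \<gamma>\<^sub>1 \<gamma>\<^sub>0 by (auto simp: active_def iter_off_iff intro!: bexI[of _ 3])
    \<comment> \<open>the same lottery also makes the conjunction fair, since now \<open>z = \<mu>\<close>\<close>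
    moreover have "?fair \<gamma>\<^sub>1 \<gamma>\<^sub>0 \<mu> j" if "j \<in> J" for j
      using J[OF that] that 6 \<gamma>\<^sub>1 \<gamma>\<^sub>0 by (auto simp: iter_val_eq)
    moreover have "\<mu> \<le> 1"
      using \<mu> 6 by simp
    ultimately show ?thesis
      using \<mu>(1) by blast
  next
    case 7
    then have "\<gamma>\<^sub>1 \<in> active ?bs J" "\<gamma>\<^sub>0 \<in> active ?bs J"
      using \<gamma>\<^sub>1 \<gamma>\<^sub>0 by (auto simp: active_def)
    moreover have "?fair \<gamma>\<^sub>1 \<gamma>\<^sub>0 (x * \<mu>) j" if "j \<in> J" for j
      using that 7 \<gamma>\<^sub>1 \<gamma>\<^sub>0 by auto
    ultimately show ?thesis
      using z by blast
  qed
qed (rule finite_range_family)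

theorem theorem16:
  fixes A B H K :: "'w set" and x y \<mu> :: real
  assumes "logically_independent A B H K"
    and "coherent [ce_bet (Cond A H) x, ce_bet (Cond B K) y]"
  shows "coherent_extension (Cond A H) (Cond B K) x y \<mu> \<longleftrightarrow>
    \<mu> \<in> {0 .. (if 0 < x \<and> x < 1 then 1 / x else 1)}"
proof -
  obtain \<omega> where \<omega>: "\<omega> \<in> A" "\<omega> \<in> H" "\<omega> \<in> K"
    using logically_independentE[OF assms(1), of True True True True] by auto
  have fin: "\<forall>b \<in> set [ce_bet (Cond A H) x, ce_bet (Cond B K) y]. finite (range (quantity b))"
    by (auto simp: finite_range_ce_val simp del: ce_val.simps)
  have x: "0 \<le> x" "x \<le> 1"
    using ce_price_bounds[OF assms(2) fin, where i = 0 and E = A and H = H and p = x] \<omega> by auto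
  have y: "0 \<le> y" "y \<le> 1"
    using ce_price_bounds[OF assms(2) fin, where i = 1 and E = B and H = K and p = y] \<omega> by auto
  have "A \<inter> H \<inter> K \<noteq> {}"
    using \<omega> by auto
  then show ?thesis
    unfolding coherent_extension_def atLeastAtMost_iff
    using iter_price_bounds[OF _ _ x] coherent_family[OF assms(1) x y] by blast
qed

end
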